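(* Let $\alpha>0$ and $\beta\ge 0$ be real numbers, and let $f\in\mathcal{A}$ satisfy $f(z)f'(z)/z\neq 0$ for all $z\in\mathbb{D}$. If at least one of the following inequalities holds for all $z\in\mathbb{D}$: (i) $\operatorname{Re}\big(\beta Q_{SD}Q_{ST}+\alpha Q_{ST}(1+Q_{ST})\big)>0$; (ii) $\operatorname{Re}\big(\beta Q_{SD}Q_{CV}+\alpha Q_{ST}(1+Q_{ST})\big)>0$; (iii) $\operatorname{Re}\big(\beta Q_{SD}Q_{ST}+\alpha Q_{CV}(1+Q_{CV})\big)>0$; (iv) $\operatorname{Re}\big(\beta Q_{SD}Q_{CV}+\alpha Q_{CV}(1+Q_{CV})\big)>0$; then $f$ is starlike.
   Context: $\mathbb{D}=\{z\in\mathbb{C}:|z|<1\}$. $\mathcal{A}$ is the class of analytic functions $f:\mathbb{D}\to\mathbb{C}$ with $f(0)=0$ and $f'(0)=1$. For $f\in\mathcal{A}$, as functions of $z\in\mathbb{D}$: $Q_{ST}=zf'(z)/f(z)$ (with the removable singularity at $z=0$ filled in, value $1$), $Q_{CV}=1+zf''(z)/f'(z)$, and $Q_{SD}=z^2\Big(\big(f''(z)/f'(z)\big)'-\tfrac12\big(f''(z)/f'(z)\big)^2\Big)$ ($z^2$ times the Schwarzian derivative of $f$). The condition $f(z)f'(z)/z\neq0$ is understood at $z=0$ via the removable singularity (where the value is $1$). A function $f\in\mathcal{A}$ is starlike if $\operatorname{Re}Q_{ST}>0$ on $\mathbb{D}$; equivalently, $f$ is univalent and $tf(z)\in f(\mathbb{D})$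 for all $z\in\mathbb{D}$, $t\in[0,1]$. *)

theory Defs
  imports "HOL-Complex_Analysis.Complex_Analysis"
begin

abbreviation unit_disc :: "complex set" where
  "unit_disc \<equiv> ball 0 1"

text \<open>Functions on the disc are represented by total functions on \<open>complex\<close>; only their values on
  the (open) disc matter, and \<open>deriv\<close> at a point of the disc depends on those values only.\<close>

definition class_A :: "(complex \<Rightarrow> complex) set" where
  "class_A = {f. f holomorphic_on unit_disc \<and> f 0 = 0 \<and> deriv f 0 = 1}"

text \<open>For \<open>f\<close> in \<open>class_A\<close>, the singularities at \<open>0\<close> of \<open>z f'(z) / f(z)\<close> and of \<open>f(z) f'(z) / z\<close>
  are removable, and both functions take the value \<open>1\<close> there. The case distinctions fill this in.\<close>

definition Q_ST :: "(complex \<Rightarrow> complex) \<Rightarrow> complex \<Rightarrow> complex" where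
  "Q_ST f z = (if z = 0 then 1 else z * deriv f z / f z)"

definition ff'_over_z :: "(complex \<Rightarrow> complex) \<Rightarrow> complex \<Rightarrow> complex" where
  "ff'_over_z f z = (if z = 0 then 1 else f z * deriv f z / z)"

definition Q_CV :: "(complex \<Rightarrow> complex) \<Rightarrow> complex \<Rightarrow> complex" where
  "Q_CV f z = 1 + z * deriv (deriv f) z / deriv f z"

definition schwarzian :: "(complex \<Rightarrow> complex) \<Rightarrow> complex \<Rightarrow> complex" where
  "schwarzian f z =
     deriv (\<lambda>w. deriv (deriv f) w / deriv f w) z - 1 / 2 * (deriv (deriv f) z / deriv f z)\<^sup>2"

definition Q_SD :: "(complex \<Rightarrow> complex) \<Rightarrow> complex \<Rightarrow> complex" where
  "Q_SD f z = z\<^sup>2 * schwarzian f z"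

text \<open>If \<open>f\<close> has a zero \<open>z \<noteq> 0\<close> in the disc, then \<open>Q_ST f z = 0\<close> by the convention \<open>x / 0 = 0\<close>, so the
  condition below fails, as it should.\<close>

definition starlike_function :: "(complex \<Rightarrow> complex) \<Rightarrow> bool" where
  "starlike_function f \<longleftrightarrow> f \<in> class_A \<and> (\<forall>z\<in>unit_disc. Re (Q_ST f z) > 0)"

end

theory Submission
  imports Defs
begin

text \<open>The proof is by contradiction at a first boundary point. Write \<open>p = Q_ST f\<close>, a holomorphic
  function with \<open>p 0 = 1\<close>. If \<open>Re p > 0\<close> fails, let \<open>z\<close> be a point of least modulus with
  \<open>Re (p z) \<le> 0\<close>; then \<open>Re p\<close> restricted to the closed disc of radius \<open>cmod z\<close> is minimal at \<open>z\<close>.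
  Minimality along the circle (first and second order) and along the radius (first order) gives
  \[ p(z) = is, \quad z p'(z) = t \le 0, \quad Re (z p'(z) + z^2 p''(z)) = m \le 0 \]
  with \<open>s\<close> and \<open>t\<close> real; this is \<open>first_boundary_point\<close>. Moreover \<open>s \<noteq> 0\<close>, because \<open>p\<close> has no zeros.

  All the quantities of the theorem are differential expressions in \<open>p\<close>: with \<open>q = Q_CV f\<close>,
  \[ q = p + z p' / p, \qquad Q_{SD} = z q' + (1 - q^2) / 2. \]
  At the point \<open>z\<close> both \<open>p\<close> and \<open>q = i (s - t / s)\<close> are purely imaginary, so \<open>p (1 + p)\<close> and
  \<open>q (1 + q)\<close> have the nonpositive real parts \<open>-s^2\<close> and \<open>-(s - t / s)^2\<close>. Multiplying
  by \<open>p\<close> or \<open>q\<close> only brings in the imaginary part of \<open>Q_SD\<close>; in \<open>z q'\<close> it comes from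
  the single summand \<open>(z p' + z^2 p'') / p\<close>, and equals \<open>-m / s\<close>. Hence \<open>Q_SD p\<close> and
  \<open>Q_SD q\<close> have the nonpositive real parts \<open>m\<close> and \<open>(1 - t / s^2) m\<close>. Each of the four
  expressions therefore has a nonpositive real part at \<open>z\<close>, contrary to its hypothesis.\<close>

section \<open>First boundary point of the right half-plane\<close>

text \<open>If the second derivative were negative, the first derivative would be negative just to the
  right of the critical point, and the function would drop below its minimum there.\<close>

lemma second_derivative_nonneg_at_minimum:
  fixes u u' :: "real \<Rightarrow> real"
  assumes u: "\<And>x. (u has_real_derivative u' x) (at x)"
    and u': "(u' has_real_derivative d) (at a)"
    and crit: "u' a = 0"
    and min: "\<And>x. u a \<le> u x"
  shows "d \<ge> 0"
proof (rule ccontr)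
  assume "\<not> d \<ge> 0"
  then obtain e where e: "e > 0" "\<And>h. 0 < h \<Longrightarrow> h < e \<Longrightarrow> u' (a + h) < u' a"
    using DERIV_neg_dec_right[OF u'] by force
  have "u (a + e / 2) < u a"
  proof (rule DERIV_neg_imp_decreasing_open[of a "a + e / 2" u])
    show "a < a + e / 2" using e(1) by simp
    show "\<exists>y. (u has_real_derivative y) (at x) \<and> y < 0" if "a < x" "x < a + e / 2" for x
      using e(2)[of "x - a"] that crit u[of x] e(1) by auto
    show "continuous_on {a..a + e / 2} u"
      by (rule DERIV_continuous_on) (rule DERIV_subset[OF u subset_UNIV])
  qed
  with min show False by (simp add: not_le[symmetric])
qed

text \<open>The conditions at the point found come from the minimality of \<open>Re p\<close> on a closed disc
  at a point \<open>z\<close> of its boundary circle: along \<open>\<theta> \<mapsto> z e\<^sup>i\<^sup>\<theta>\<close> the first two derivatives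
  of \<open>p\<close> are \<open>i z p'\<close> and \<open>-(z p' + z\<^sup>2 p'')\<close>, and along the radius the outward
  derivative is \<open>z p'\<close>.\<close>

lemma first_boundary_point:
  fixes p :: "complex \<Rightarrow> complex"
  assumes hol: "p holomorphic_on ball 0 R"
    and pos0: "Re (p 0) > 0"
    and w: "w \<in> ball 0 R" "Re (p w) \<le> 0"
  obtains z where "z \<in> ball 0 R" "z \<noteq> 0" "Re (p z) = 0"
    "Im (z * deriv p z) = 0" "Re (z * deriv p z) \<le> 0"
    "Re (z * deriv p z + z\<^sup>2 * deriv (deriv p) z) \<le> 0"
proof -
  let ?K = "{z \<in> cball 0 (norm w). Re (p z) \<le> 0}"
  have sub: "cball 0 (norm w) \<subseteq> ball 0 R" using w by auto
  have cont: "continuous_on (cball 0 (norm w)) (\<lambda>z. Re (p z))"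
    by (intro continuous_intros continuous_on_subset[OF holomorphic_on_imp_continuous_on[OF hol] sub])
  have "closed ?K"
    using continuous_closed_preimage[OF cont closed_cball closed_atMost[of 0]]
    by (simp add: vimage_def Int_def)
  moreover have "bounded ?K" by (rule bounded_subset[OF bounded_cball[of 0 "norm w"]]) auto
  ultimately have "compact ?K" by (simp add: compact_eq_bounded_closed)
  moreover have "?K \<noteq> {}" using w by auto
  ultimately obtain z where zK: "z \<in> ?K" and zmin: "\<And>y. y \<in> ?K \<Longrightarrow> norm z \<le> norm y"
    using continuous_attains_inf[of ?K norm] continuous_on_norm_id by blast
  have z: "z \<in> ball 0 R" "Re (p z) \<le> 0" using subsetD[OF sub, of z] zK by auto
  have z0: "z \<noteq> 0" using pos0 z(2) by auto
  have inside: "Re (p y) > 0" if "norm y < norm z" for y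
    using zmin[of y] zK that by force
  have nonneg: "Re (p y) \<ge> 0" if "norm y \<le> norm z" for y
  proof (rule continuous_ge_on_closure[where S = "ball 0 (norm z)" and f = "\<lambda>z. Re (p z)"])
    show "y \<in> closure (ball 0 (norm z))" using that z0 by simp
    have "cball 0 (norm z) \<subseteq> cball 0 (norm w)" using zK by auto
    then show "continuous_on (closure (ball 0 (norm z))) (\<lambda>z. Re (p z))"
      using continuous_on_subset[OF cont] z0 by simp
  qed (use inside in \<open>auto simp: less_imp_le\<close>)
  have pz: "Re (p z) = 0" using nonneg[of z] z(2) by simp

  have dp: "(p has_field_derivative deriv p y) (at y)" if "y \<in> ball 0 R" for y
    using hol that by (intro holomorphic_derivI) auto
  have dp': "(deriv p has_field_derivative deriv (deriv p) y) (at y)" if "y \<in> ball 0 R" for y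
    using holomorphic_deriv[OF hol] that by (intro holomorphic_derivI) auto
  define c where "c = (\<lambda>x::real. z * exp (\<i> * of_real x))"
  have normc: "norm (c x) = norm z" for x by (simp add: c_def norm_mult)
  have cR: "c x \<in> ball 0 R" for x using z(1) normc by simp
  have c0: "c 0 = z" by (simp add: c_def)
  have dc: "(c has_vector_derivative \<i> * c x) (at x)" for x
    unfolding c_def by (rule has_vector_derivative_real_field) (auto intro!: derivative_eq_intros)
  define u where "u = (\<lambda>x. Re (p (c x)))"
  define u' where "u' = (\<lambda>x. Re (\<i> * c x * deriv p (c x)))"
  have du: "(u has_real_derivative u' x) (at x)" for x
    unfolding u_def u'_def
    by (intro has_field_derivative_Re field_vector_diff_chain_at[OF dc dp[OF cR], unfolded o_def])
  have "((\<lambda>x. \<i> * (c x * deriv p (c x))) has_vector_derivative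
          \<i> * (c 0 * (\<i> * c 0 * deriv (deriv p) (c 0)) + \<i> * c 0 * deriv p (c 0))) (at 0)"
    by (intro has_vector_derivative_mult_right has_vector_derivative_mult dc
        field_vector_diff_chain_at[OF dc dp'[OF cR], unfolded o_def])
  from has_field_derivative_Re[OF this]
  have du': "(u' has_real_derivative - Re (z * deriv p z + z\<^sup>2 * deriv (deriv p) z)) (at 0)"
    unfolding u'_def c0
    by (simp add: algebra_simps power2_eq_square)
  have umin: "u 0 \<le> u x" for x
    using nonneg[of "c x"] pz by (simp add: u_def c0 normc)
  have crit: "u' 0 = 0"
    using DERIV_local_min[OF du, of 1 0] umin by auto
  have second: "Re (z * deriv p z + z\<^sup>2 * deriv (deriv p) z) \<le> 0"
    using second_derivative_nonneg_at_minimum[OF du du' crit umin] by simp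

  have real: "Im (z * deriv p z) = 0"
    using crit by (simp add: u'_def c0 algebra_simps)
  have dl: "((\<lambda>x. of_real x * z) has_vector_derivative z) (at 1)"
    using has_vector_derivative_real_field[of "\<lambda>x. x * z" z 1]
    by (auto intro!: derivative_eq_intros)
  have dr: "((\<lambda>x. Re (p (of_real x * z))) has_real_derivative Re (z * deriv p z)) (at 1)"
    using field_vector_diff_chain_at[OF dl, of p "deriv p z"] dp[OF z(1)]
    by (intro has_field_derivative_Re) (simp add: o_def)
  have radial: "Re (z * deriv p z) \<le> 0"
  proof (rule ccontr)
    assume "\<not> Re (z * deriv p z) \<le> 0"
    then obtain e where e: "e > 0"
        "\<And>h. 0 < h \<Longrightarrow> h < e \<Longrightarrow> Re (p (of_real (1 - h) * z)) < Re (p z)"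
      using DERIV_pos_inc_left[OF dr] by force
    \<comment> \<open>The bound \<open>h \<le> 1\<close> keeps the shrunken point \<open>(1 - h) z\<close> in the disc of radius \<open>cmod z\<close>.\<close>
    define h where "h = min 1 (e / 2)"
    have h: "0 < h" "h < e" "h \<le> 1" using e(1) by (auto simp: h_def)
    have "norm (of_real (1 - h) * z) \<le> norm z"
      unfolding norm_mult norm_of_real using h by (simp add: mult_left_le_one_le)
    from nonneg[OF this] e(2)[OF h(1,2)] pz show False by simp
  qed
  show thesis by (rule that[OF z(1) z0 pz real radial second])
qed

section \<open>The quantities of the theorem in terms of p = z f' / f\<close>

lemma ff'_over_z_nonzeroD:
  assumes "\<forall>z\<in>unit_disc. ff'_over_z f z \<noteq> 0" and "z \<in> unit_disc" "z \<noteq> 0"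
  shows "f z \<noteq> 0" "deriv f z \<noteq> 0"
  using assms(1)[rule_format, OF assms(2)] assms(3) by (auto simp: ff'_over_z_def)

text \<open>Dividing the zero of \<open>f\<close> at the origin out of the denominator removes the singularity:
  \<open>z f' / f\<close> is the quotient of \<open>f'\<close> by the difference quotient \<open>f / z\<close>.\<close>

lemma holomorphic_Q_ST:
  assumes f: "f \<in> class_A" and nz: "\<forall>z\<in>unit_disc. ff'_over_z f z \<noteq> 0"
  shows "Q_ST f holomorphic_on unit_disc"
proof -
  have hol: "f holomorphic_on unit_disc" and f0: "f 0 = 0" and f1: "deriv f 0 = 1"
    using f by (auto simp: class_A_def)
  define g where "g = (\<lambda>z. if z = 0 then deriv f 0 else (f z - f 0) / (z - 0))"
  have "g holomorphic_on unit_disc"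
    unfolding g_def using hol by (rule pole_lemma) simp
  moreover have "g z \<noteq> 0" if "z \<in> unit_disc" for z
    using ff'_over_z_nonzeroD(1)[OF nz that] f0 f1 by (auto simp: g_def)
  moreover have "deriv f holomorphic_on unit_disc" using hol by (simp add: holomorphic_deriv)
  ultimately have "(\<lambda>z. deriv f z / g z) holomorphic_on unit_disc"
    by (intro holomorphic_on_divide)
  then show ?thesis
    by (rule holomorphic_transform) (auto simp: Q_ST_def g_def f0 f1)
qed

text \<open>Logarithmic differentiation of \<open>p = z f' / f\<close>.\<close>

lemma Q_CV_eq_Q_ST:
  assumes hol: "f holomorphic_on unit_disc"
    and z: "z \<in> unit_disc" "z \<noteq> 0" and nz: "f z \<noteq> 0" "deriv f z \<noteq> 0"
  shows "Q_CV f z = Q_ST f z + z * deriv (Q_ST f) z / Q_ST f z"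
proof -
  have df: "(f has_field_derivative deriv f z) (at z)"
    using hol z by (intro holomorphic_derivI) auto
  have df': "(deriv f has_field_derivative deriv (deriv f) z) (at z)"
    using holomorphic_deriv[OF hol] z by (intro holomorphic_derivI) auto
  have "((\<lambda>w. w * deriv f w / f w) has_field_derivative
          ((deriv f z + z * deriv (deriv f) z) * f z - z * deriv f z * deriv f z) / (f z * f z)) (at z)"
    using nz by (auto intro!: derivative_eq_intros df df' simp: algebra_simps)
  then have "(Q_ST f has_field_derivative
          ((deriv f z + z * deriv (deriv f) z) * f z - z * deriv f z * deriv f z) / (f z * f z)) (at z)"
    by (rule has_field_derivative_transform_within_open[of _ _ _ "- {0}"])
      (use z in \<open>auto simp: Q_ST_def\<close>)
  from DERIV_imp_deriv[OF this] show ?thesis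
    using z nz by (simp add: Q_ST_def Q_CV_def field_simps)
qed

text \<open>With \<open>h = f'' / f'\<close> and \<open>q = 1 + z h\<close>, both sides equal \<open>z\<^sup>2 (h' - h\<^sup>2 / 2)\<close>.\<close>

lemma Q_SD_eq_Q_CV:
  assumes hol: "f holomorphic_on unit_disc"
    and z: "z \<in> unit_disc" and nz: "deriv f z \<noteq> 0"
  shows "Q_SD f z = z * deriv (Q_CV f) z + (1 - (Q_CV f z)\<^sup>2) / 2"
proof -
  define h where "h = (\<lambda>w. deriv (deriv f) w / deriv f w)"
  have "deriv f field_differentiable at z" "deriv (deriv f) field_differentiable at z"
    using hol z by (auto intro!: holomorphic_on_imp_differentiable_at[of _ unit_disc] holomorphic_deriv)
  then have "h field_differentiable at z"
    unfolding h_def using nz by (intro field_differentiable_divide)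
  then have "(h has_field_derivative deriv h z) (at z)"
    by (rule field_differentiable_derivI)
  then have "((\<lambda>w. 1 + w * h w) has_field_derivative h z + z * deriv h z) (at z)"
    by (auto intro!: derivative_eq_intros)
  moreover have "Q_CV f = (\<lambda>w. 1 + w * h w)" by (auto simp: Q_CV_def h_def)
  ultimately have "deriv (Q_CV f) z = h z + z * deriv h z" "Q_CV f z = 1 + z * h z"
    by (auto intro: DERIV_imp_deriv)
  moreover have "Q_SD f z = z\<^sup>2 * (deriv h z - 1 / 2 * (h z)\<^sup>2)"
    by (simp add: Q_SD_def schwarzian_def h_def)
  ultimately show ?thesis by (simp add: power2_eq_square field_simps)
qed

text \<open>The derivative of \<open>q = p + z p' / p\<close>, grouped so that \<open>p''\<close> enters only through
  \<open>z p' + z\<^sup>2 p''\<close>, the combination whose real part \<open>first_boundary_point\<close> controls.\<close>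

lemma z_deriv_Q_CV:
  assumes f: "f \<in> class_A" and nz: "\<forall>z\<in>unit_disc. ff'_over_z f z \<noteq> 0"
    and z: "z \<in> unit_disc" "z \<noteq> 0"
  defines "p \<equiv> Q_ST f"
  shows "z * deriv (Q_CV f) z =
    z * deriv p z + (z * deriv p z + z\<^sup>2 * deriv (deriv p) z) / p z - (z * deriv p z / p z)\<^sup>2"
proof -
  have hol: "f holomorphic_on unit_disc" using f by (simp add: class_A_def)
  have nz': "f w \<noteq> 0 \<and> deriv f w \<noteq> 0" if "w \<in> unit_disc - {0}" for w
    using ff'_over_z_nonzeroD[OF nz] that by blast
  have pz: "p z \<noteq> 0" using nz'[of z] z by (simp add: p_def Q_ST_def)
  have holp: "p holomorphic_on unit_disc" unfolding p_def by (rule holomorphic_Q_ST[OF f nz])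
  have dp: "(p has_field_derivative deriv p z) (at z)"
    using holp z by (intro holomorphic_derivI) auto
  have dp': "(deriv p has_field_derivative deriv (deriv p) z) (at z)"
    using holomorphic_deriv[OF holp] z by (intro holomorphic_derivI) auto
  have "((\<lambda>w. p w + w * deriv p w / p w) has_field_derivative deriv p z +
         ((deriv p z + z * deriv (deriv p) z) * p z - z * deriv p z * deriv p z) / (p z * p z)) (at z)"
    using pz by (auto intro!: derivative_eq_intros dp dp' simp: algebra_simps)
  then have "(Q_CV f has_field_derivative deriv p z +
         ((deriv p z + z * deriv (deriv p) z) * p z - z * deriv p z * deriv p z) / (p z * p z)) (at z)"
    by (rule has_field_derivative_transform_within_open[of _ _ _ "unit_disc - {0}"])
      (use z nz' in \<open>auto simp: p_def Q_CV_eq_Q_ST[OF hol]\<close>)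
  note deriv_q = DERIV_imp_deriv[OF this]
  show ?thesis
    unfolding deriv_q using pz by (simp add: field_simps power2_eq_square)
qed

section \<open>Starlikeness\<close>

theorem theorem2p8:
  fixes \<alpha> \<beta> :: real and f :: "complex \<Rightarrow> complex"
  assumes "\<alpha> > 0" and "\<beta> \<ge> 0"
    and "f \<in> class_A"
    and "\<forall>z\<in>unit_disc. ff'_over_z f z \<noteq> 0"
    and "(\<forall>z\<in>unit_disc. Re (of_real \<beta> * Q_SD f z * Q_ST f z
                              + of_real \<alpha> * Q_ST f z * (1 + Q_ST f z)) > 0)
       \<or> (\<forall>z\<in>unit_disc. Re (of_real \<beta> * Q_SD f z * Q_CV f z
                              + of_real \<alpha> * Q_ST f z * (1 + Q_ST f z)) > 0)
       \<or> (\<forall>z\<in>unit_disc. Re (of_real \<beta> * Q_SD f z * Q_ST f z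
                              + of_real \<alpha> * Q_CV f z * (1 + Q_CV f z)) > 0)
       \<or> (\<forall>z\<in>unit_disc. Re (of_real \<beta> * Q_SD f z * Q_CV f z
                              + of_real \<alpha> * Q_CV f z * (1 + Q_CV f z)) > 0)"
  shows "starlike_function f"
proof (rule ccontr)
  let ?p = "Q_ST f" and ?q = "Q_CV f"
  have hol: "f holomorphic_on unit_disc" using assms(3) by (simp add: class_A_def)
  assume "\<not> starlike_function f"
  then obtain w where w: "w \<in> unit_disc" "Re (?p w) \<le> 0"
    using assms(3) by (force simp: starlike_function_def)
  have p0: "Re (?p 0) > 0" by (simp add: Q_ST_def)
  obtain z where z: "z \<in> unit_disc" "z \<noteq> 0" and Re_p: "Re (?p z) = 0"
    and Im_t: "Im (z * deriv ?p z) = 0" and Re_t: "Re (z * deriv ?p z) \<le> 0"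
    and Re_m: "Re (z * deriv ?p z + z\<^sup>2 * deriv (deriv ?p) z) \<le> 0"
    by (rule first_boundary_point[OF holomorphic_Q_ST[OF assms(3,4)] p0 w])
  note nz = ff'_over_z_nonzeroD[OF assms(4) z]

  define s where "s = Im (?p z)"
  define t where "t = Re (z * deriv ?p z)"
  define M where "M = z * deriv ?p z + z\<^sup>2 * deriv (deriv ?p) z"
  have p: "?p z = \<i> * of_real s" using Re_p by (simp add: s_def complex_eq_iff)
  have t: "z * deriv ?p z = of_real t" using Im_t by (simp add: t_def complex_eq_iff)
  have s0: "s \<noteq> 0"
    using p nz z by (auto simp: Q_ST_def)
  have t0: "t \<le> 0" and m0: "Re M \<le> 0" using Re_t Re_m by (simp_all add: t_def M_def)
  have q: "?q z = \<i> * of_real (s - t / s)"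
    unfolding Q_CV_eq_Q_ST[OF hol z nz] t p using s0
    by (simp add: complex_eq_iff Re_divide Im_divide power2_eq_square)
  \<comment> \<open>Only the summand \<open>M / p\<close> of \<open>Q_SD\<close> can have an imaginary part.\<close>
  have "Q_SD f z = of_real (t + t\<^sup>2 / s\<^sup>2 + (1 + (s - t / s)\<^sup>2) / 2) + M / (\<i> * of_real s)"
    unfolding Q_SD_eq_Q_CV[OF hol z(1) nz(2)] z_deriv_Q_CV[OF assms(3,4) z] q M_def[symmetric]
    unfolding t p by (simp add: power_mult_distrib power_divide)
  then have Im_SD: "Im (Q_SD f z) = - Re M / s"
    using s0 by (simp add: Im_divide power2_eq_square)

  have Re_imag: "Re (v * (\<i> * of_real r)) = - r * Im v" for v r by simp
  have SD_p: "Re (Q_SD f z * ?p z) \<le> 0"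
    unfolding p Re_imag Im_SD using s0 m0 by simp
  have "(1 - t / s\<^sup>2) * Re M \<le> 0"
    using t0 m0 by (intro mult_nonneg_nonpos) (simp_all add: divide_nonpos_nonneg order.trans[of _ 0])
  then have SD_q: "Re (Q_SD f z * ?q z) \<le> 0"
    unfolding q Re_imag Im_SD using s0 by (simp add: field_simps power2_eq_square)
  have imag: "Re (v * (1 + v)) \<le> 0" if "v = \<i> * of_real r" for v r
    using that by (simp add: algebra_simps)
  have combine: "Re (of_real \<beta> * Q_SD f z * a + of_real \<alpha> * b * (1 + b)) \<le> 0"
    if "Re (Q_SD f z * a) \<le> 0" "Re (b * (1 + b)) \<le> 0" for a b
  proof -
    have "Re (of_real \<beta> * Q_SD f z * a + of_real \<alpha> * b * (1 + b)) =
        \<beta> * Re (Q_SD f z * a) + \<alpha> * Re (b * (1 + b))"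
      unfolding mult.assoc by simp
    also have "\<dots> \<le> 0"
      using that assms(1,2) by (intro add_nonpos_nonpos mult_nonneg_nonpos) auto
    finally show ?thesis .
  qed
  from assms(5) z(1) show False
    using combine[OF SD_p imag[OF p]] combine[OF SD_q imag[OF p]]
      combine[OF SD_p imag[OF q]] combine[OF SD_q imag[OF q]]
    by (meson not_le)
qed

end
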